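(* Let $X$ be a metrizable, separable, locally compact space and let $\mathcal F=\{f_1,\dots,f_m\}$ be an iterated function system on $X$ with compact dynamics. Assume that the global attractor $\mathcal G_{\mathcal F}$ is connected and that $\mathcal F$ has backward recurrent access. Then the orbitwise chain graph $\Gamma^{ow}_{\mathcal C_{\mathcal F}}$ of $\mathcal F$ is connected.
   Context: Fix any metric $d$ on $X$ compatible with its topology. An iterated function system (IFS) on $X$ is a finite collection $\mathcal F=\{f_1,\dots,f_m\}$, $m\ge1$, of continuous maps $X\to X$. $\mathcal I^m$ is the set of all finite words in the letters $1,\dots,m$ (including the empty word $0$); $|I|$ is the length of $I$. For $I=i_1\cdots i_k$, $\Phi^I_{\mathcal F}=f_{i_k}\circ\dots\circ f_{i_1}$, and $\Phi^0_{\mathcal F}=\mathrm{id}_X$. $H_{\mathcal F}(A)=\bigcup_{i=1}^m f_i(A)$; $A$ is $H$-invariant if $H_{\mathcal F}(A)=A$. The orbit of $x$ is $\mathcal O_{\mathcal F}(x)=\{\Phi^I_{\mathcal F}(x): I\in\mathcal I^m\}$. $N_\varepsilon(A)=\{x:d(x,A)<\varepsilon\}$. $A$ attracts $K$ if for every $\varepsilon>0$ there is $\tau>0$ with $\Phi^I_{\mathcal F}(K)\subset N_\varepsilon(A)$ for every $|I|\ge\tau$. A global attractor is a compact $H$-invariant set that attracts every compact subset of $X$; it is unique if it exists and is denoted $\mathcal G_{\mathcal F}$. $\mathcal F$ has compact dynamics if it has a global attractor. Chains: an $\varepsilon$-chain from $x$ to $y$ is a finite sequence $x_0=x,x_1,\dots,x_k=y$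 ($k\ge0$) in $X$ with indices $i_0,\dots,i_{k-1}$ such that $d(f_{i_n}(x_n),x_{n+1})<\varepsilon$ for $n=0,\dots,k-1$. Write $x\succcurlyeq y$ if for every $\varepsilon>0$ there is an $\varepsilon$-chain from $x$ to $y$; $x,y$ are chain-equivalent if $x\succcurlyeq y$ and $y\succcurlyeq x$. A point $x$ is orbitwise chain-recurrent if it is chain-equivalent to every point of $\mathcal O_{\mathcal F}(x)$; the set of such points is $\mathcal R^{ow}_{\mathcal C_{\mathcal F}}$. Orbitwise chain nodes are the chain-equivalence classes of $\mathcal R^{ow}_{\mathcal C_{\mathcal F}}$. The orbitwise chain graph $\Gamma^{ow}_{\mathcal C_{\mathcal F}}$ has the orbitwise chain nodes as vertices, with a directed edge from $N_1$ to $N_2\ne N_1$ when $x\succcurlyeq y$ for some $x\in N_1,y\in N_2$. Connectedness: a nodes partition is a splitting of the set of all nodes of the graph into two non-empty disjoint collections $\mathcal N_1,\mathcal N_2$ such that the unions $\bigcup_{M\in\mathcal N_1}M$ and $\bigcup_{M\in\mathcal N_2}M$ are closed (and disjoint) subsets of $X$. The graph is connected if, for every nodes partition, there is an edge from a node of one collection to a node of the other. $\mathcal F$ has backward recurrent access if for every $x\in\mathcal G_{\mathcal F}$ there is a backward trajectory $b^-=(x_0=x,x_{-1},x_{-2},\dots)$ contained in $\mathcal G_{\mathcal F}$ (that is, for each $n\ge1$ there is a generator $f_i$ with $f_i(x_{-n})=x_{-n+1}$) such that $\alpha(b^-)\cap\mathcal R^{ow}_{\mathcal C_{\mathcal F}}\ne\emptyset$,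 where $\alpha(b^-)$ is the set of limits of subsequences $x_{-n_k}$ with $n_k\to\infty$. *)

theory Defs
  imports "HOL-Analysis.Analysis"
begin

text \<open>
  The phase space \<open>X\<close> is the whole of a type of class \<^class>\<open>metric_space\<close>: its topology is
  metrizable by construction, and \<^const>\<open>dist\<close> is an arbitrary compatible metric.
  A system \<open>{f\<^sub>1, \<dots>, f\<^sub>m}\<close> is given by \<open>m\<close> and an indexed family \<open>f\<close>,
  of which only the values at the indices \<open>1, \<dots>, m\<close> matter.
\<close>

definition ifs :: "nat \<Rightarrow> (nat \<Rightarrow> 'a::metric_space \<Rightarrow> 'a) \<Rightarrow> bool" where
  "ifs m f \<longleftrightarrow> 1 \<le> m \<and> (\<forall>i\<in>{1..m}. continuous_on UNIV (f i))"

text \<open>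
  The word \<open>I = i\<^sub>1 \<dots> i\<^sub>k\<close> is the list \<open>[i\<^sub>1, \<dots>, i\<^sub>k]\<close>; since \<open>i\<^sub>1\<close> acts first,
  the map of \<open>I\<close> is \<open>fold f I\<close>, which equals \<open>f i\<^sub>k \<circ> \<dots> \<circ> f i\<^sub>1\<close>.
\<close>

definition words :: "nat \<Rightarrow> nat list set" where
  "words m = lists {1..m}"

definition word_map :: "(nat \<Rightarrow> 'a \<Rightarrow> 'a) \<Rightarrow> nat list \<Rightarrow> 'a \<Rightarrow> 'a" where
  "word_map f I = fold f I"

definition hutchinson :: "nat \<Rightarrow> (nat \<Rightarrow> 'a \<Rightarrow> 'a) \<Rightarrow> 'a set \<Rightarrow> 'a set" where
  "hutchinson m f A = (\<Union>i\<in>{1..m}. f i ` A)"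

definition H_invariant :: "nat \<Rightarrow> (nat \<Rightarrow> 'a \<Rightarrow> 'a) \<Rightarrow> 'a set \<Rightarrow> bool" where
  "H_invariant m f A \<longleftrightarrow> hutchinson m f A = A"

definition orbit_of :: "nat \<Rightarrow> (nat \<Rightarrow> 'a \<Rightarrow> 'a) \<Rightarrow> 'a \<Rightarrow> 'a set" where
  "orbit_of m f x = {word_map f I x | I. I \<in> words m}"

text \<open>
  Written as a union of balls, because \<open>infdist x {} = 0\<close> in the library, which would make every
  neighbourhood of the empty set the whole space.
\<close>

definition nbhd :: "real \<Rightarrow> 'a::metric_space set \<Rightarrow> 'a set" where
  "nbhd \<epsilon> A = (\<Union>a\<in>A. ball a \<epsilon>)"

definition attracts :: "nat \<Rightarrow> (nat \<Rightarrow> 'a::metric_space \<Rightarrow> 'a) \<Rightarrow> 'a set \<Rightarrow> 'a set \<Rightarrow> bool" where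
  "attracts m f A K \<longleftrightarrow>
    (\<forall>\<epsilon>>0. \<exists>\<tau>::nat. \<tau> > 0 \<and> (\<forall>I\<in>words m. length I \<ge> \<tau> \<longrightarrow> word_map f I ` K \<subseteq> nbhd \<epsilon> A))"

definition is_global_attractor :: "nat \<Rightarrow> (nat \<Rightarrow> 'a::metric_space \<Rightarrow> 'a) \<Rightarrow> 'a set \<Rightarrow> bool" where
  "is_global_attractor m f G \<longleftrightarrow>
    compact G \<and> H_invariant m f G \<and> (\<forall>K. compact K \<longrightarrow> attracts m f G K)"

definition compact_dynamics :: "nat \<Rightarrow> (nat \<Rightarrow> 'a::metric_space \<Rightarrow> 'a) \<Rightarrow> bool" where
  "compact_dynamics m f \<longleftrightarrow> (\<exists>G. is_global_attractor m f G)"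

text \<open>Meaningful only under \<open>compact_dynamics m f\<close>; see the uniqueness lemma below.\<close>

definition global_attractor :: "nat \<Rightarrow> (nat \<Rightarrow> 'a::metric_space \<Rightarrow> 'a) \<Rightarrow> 'a set" where
  "global_attractor m f = (THE G. is_global_attractor m f G)"

lemma H_invariant_word_preimage:
  assumes "H_invariant m f A" and "a \<in> A"
  shows "\<exists>I\<in>words m. length I = k \<and> (\<exists>b\<in>A. word_map f I b = a)"
  using assms(2)
proof (induction k arbitrary: a)
  case 0
  then show ?case by (intro bexI[of _ "[]"]) (auto simp: words_def word_map_def)
next
  case (Suc k)
  have "a \<in> hutchinson m f A"
    using assms(1) Suc.prems by (simp add: H_invariant_def)
  then obtain i b where i: "i \<in> {1..m}" "b \<in> A" "f i b = a"
    by (auto simp: hutchinson_def)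
  then obtain I c where "I \<in> words m" "length I = k" "c \<in> A" "word_map f I c = b"
    using Suc.IH by blast
  then show ?case
    using i by (intro bexI[of _ "I @ [i]"]) (auto simp: words_def word_map_def)
qed

lemma global_attractor_subset:
  assumes "is_global_attractor m f A" and "is_global_attractor m f B"
  shows "A \<subseteq> B"
proof
  fix a assume a: "a \<in> A"
  have inv: "H_invariant m f A" and att: "attracts m f B A" and B: "closed B"
    using assms by (auto simp: is_global_attractor_def compact_imp_closed)
  have "\<exists>b\<in>B. dist b a < \<epsilon>" if "\<epsilon> > 0" for \<epsilon>
  proof -
    obtain \<tau> :: nat where \<tau>: "\<forall>I\<in>words m. length I \<ge> \<tau> \<longrightarrow> word_map f I ` A \<subseteq> nbhd \<epsilon> B"
      using att \<open>\<epsilon> > 0\<close> unfolding attracts_def by metis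
    obtain I c where "I \<in> words m" "length I = \<tau>" "c \<in> A" "word_map f I c = a"
      using H_invariant_word_preimage[OF inv a] by blast
    then have "a \<in> nbhd \<epsilon> B"
      using \<tau> by blast
    then show ?thesis by (auto simp: nbhd_def)
  qed
  then have "a \<in> closure B"
    by (simp add: closure_approachable)
  then show "a \<in> B" using B by simp
qed

lemma is_global_attractor_unique:
  "is_global_attractor m f A \<Longrightarrow> is_global_attractor m f B \<Longrightarrow> A = B"
  by (intro subset_antisym global_attractor_subset)

lemma global_attractor_eqI:
  "is_global_attractor m f G \<Longrightarrow> global_attractor m f = G"
  unfolding global_attractor_def
  by (rule the_equality) (assumption, rule is_global_attractor_unique)

definition has_chain ::
  "nat \<Rightarrow> (nat \<Rightarrow> 'a::metric_space \<Rightarrow> 'a) \<Rightarrow> real \<Rightarrow> 'a \<Rightarrow> 'a \<Rightarrow> bool" where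
  "has_chain m f \<epsilon> x y \<longleftrightarrow>
    (\<exists>(k::nat) (xs::nat \<Rightarrow> 'a) (is::nat \<Rightarrow> nat). xs 0 = x \<and> xs k = y \<and>
      (\<forall>n<k. is n \<in> {1..m} \<and> dist (f (is n) (xs n)) (xs (Suc n)) < \<epsilon>))"

definition chain_ge :: "nat \<Rightarrow> (nat \<Rightarrow> 'a::metric_space \<Rightarrow> 'a) \<Rightarrow> 'a \<Rightarrow> 'a \<Rightarrow> bool" where
  "chain_ge m f x y \<longleftrightarrow> (\<forall>\<epsilon>>0. has_chain m f \<epsilon> x y)"

definition chain_equivalent :: "nat \<Rightarrow> (nat \<Rightarrow> 'a::metric_space \<Rightarrow> 'a) \<Rightarrow> 'a \<Rightarrow> 'a \<Rightarrow> bool" where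
  "chain_equivalent m f x y \<longleftrightarrow> chain_ge m f x y \<and> chain_ge m f y x"

definition ow_chain_recurrent :: "nat \<Rightarrow> (nat \<Rightarrow> 'a::metric_space \<Rightarrow> 'a) \<Rightarrow> 'a set" where
  "ow_chain_recurrent m f = {x. \<forall>y\<in>orbit_of m f x. chain_equivalent m f x y}"

text \<open>
  A point chain-equivalent to an orbitwise chain-recurrent one need not itself be orbitwise
  chain-recurrent, so the relation is restricted to the recurrent set before taking classes.
\<close>

definition ow_chain_nodes :: "nat \<Rightarrow> (nat \<Rightarrow> 'a::metric_space \<Rightarrow> 'a) \<Rightarrow> 'a set set" where
  "ow_chain_nodes m f =
    ow_chain_recurrent m f //
      {(x, y). x \<in> ow_chain_recurrent m f \<and> y \<in> ow_chain_recurrent m f \<and> chain_equivalent m f x y}"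

definition ow_chain_edges :: "nat \<Rightarrow> (nat \<Rightarrow> 'a::metric_space \<Rightarrow> 'a) \<Rightarrow> ('a set \<times> 'a set) set" where
  "ow_chain_edges m f =
    {(N1, N2). N1 \<in> ow_chain_nodes m f \<and> N2 \<in> ow_chain_nodes m f \<and> N2 \<noteq> N1 \<and>
      (\<exists>x\<in>N1. \<exists>y\<in>N2. chain_ge m f x y)}"

definition nodes_partition ::
  "'a::topological_space set set \<Rightarrow> 'a set set \<Rightarrow> 'a set set \<Rightarrow> bool" where
  "nodes_partition V P Q \<longleftrightarrow>
    P \<union> Q = V \<and> P \<inter> Q = {} \<and> P \<noteq> {} \<and> Q \<noteq> {} \<and>
    closed (\<Union>P) \<and> closed (\<Union>Q) \<and> \<Union>P \<inter> \<Union>Q = {}"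

text \<open>The two collections play symmetric roles, so the connecting edge may go either way.\<close>

definition graph_connected ::
  "'a::topological_space set set \<Rightarrow> ('a set \<times> 'a set) set \<Rightarrow> bool" where
  "graph_connected V E \<longleftrightarrow>
    (\<forall>P Q. nodes_partition V P Q \<longrightarrow> (\<exists>M\<in>P. \<exists>N\<in>Q. (M, N) \<in> E \<or> (N, M) \<in> E))"

text \<open>Backward sequences are indexed by naturals: \<open>b n\<close> stands for \<open>x\<^bsub>-n\<^esub>\<close>.\<close>

definition backward_trajectory ::
  "nat \<Rightarrow> (nat \<Rightarrow> 'a \<Rightarrow> 'a) \<Rightarrow> 'a \<Rightarrow> (nat \<Rightarrow> 'a) \<Rightarrow> bool" where
  "backward_trajectory m f x b \<longleftrightarrow>
    b 0 = x \<and> (\<forall>n. \<exists>i\<in>{1..m}. f i (b (Suc n)) = b n)"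

definition alpha_limit :: "(nat \<Rightarrow> 'a::metric_space) \<Rightarrow> 'a set" where
  "alpha_limit b = {y. \<exists>r::nat \<Rightarrow> nat. strict_mono r \<and> (b \<circ> r) \<longlonglongrightarrow> y}"

definition backward_recurrent_access ::
  "nat \<Rightarrow> (nat \<Rightarrow> 'a::metric_space \<Rightarrow> 'a) \<Rightarrow> bool" where
  "backward_recurrent_access m f \<longleftrightarrow>
    (\<forall>x\<in>global_attractor m f. \<exists>b. backward_trajectory m f x b \<and>
      range b \<subseteq> global_attractor m f \<and>
      alpha_limit b \<inter> ow_chain_recurrent m f \<noteq> {})"

end

theory Submission
  imports Defs
begin

text \<open>
  On the compact attractor the chain relation is a closed preorder, so by Zorn every point chains
  down to a minimal point, and minimal points are orbitwise chain-recurrent. By backward recurrent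
  access every point of the attractor also lies below a recurrent point. Given a nodes partition,
  the points of the attractor lying below the two halves form two closed sets covering it.
  Connectedness yields a common point, and a recurrent point below that one belongs to one of the
  halves and lies below a node of the other, which is an edge. The two closed sets are non-empty
  because every point, whether or not it lies on the attractor, chains down to the attractor.
\<close>

section \<open>Chains as paths of a one-step relation\<close>

text \<open>With the index of the map hidden in the relation, chains become elements of the
  reflexive transitive closure, so concatenation and monotonicity come for free, and the transitive
  closure singles out chains with at least one step.\<close>

definition chain_step ::
  "nat \<Rightarrow> (nat \<Rightarrow> 'a::metric_space \<Rightarrow> 'a) \<Rightarrow> real \<Rightarrow> ('a \<times> 'a) set" where
  "chain_step m f \<epsilon> = {(x, y). \<exists>i\<in>{1..m}. dist (f i x) y < \<epsilon>}"

lemma has_chain_iff: "has_chain m f \<epsilon> x y \<longleftrightarrow> (x, y) \<in> (chain_step m f \<epsilon>)\<^sup>*"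
proof -
  have "has_chain m f \<epsilon> x y \<longleftrightarrow>
    (\<exists>k xs. xs 0 = x \<and> xs k = y \<and> (\<forall>n<k. (xs n, xs (Suc n)) \<in> chain_step m f \<epsilon>))"
    (is "_ \<longleftrightarrow> ?R")
  proof
    assume "has_chain m f \<epsilon> x y"
    then show ?R unfolding has_chain_def chain_step_def by blast
  next
    assume ?R
    then obtain k xs where xs: "xs 0 = x" "xs k = y"
      and "\<forall>n<k. \<exists>i. i \<in> {1..m} \<and> dist (f i (xs n)) (xs (Suc n)) < \<epsilon>"
      unfolding chain_step_def by blast
    then obtain js where
      "\<forall>n<k. js n \<in> {1..m} \<and> dist (f (js n) (xs n)) (xs (Suc n)) < \<epsilon>"
      by metis
    then show "has_chain m f \<epsilon> x y"
      unfolding has_chain_def using xs by blast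
  qed
  then show ?thesis
    by (simp add: rtrancl_power relpow_fun_conv)
qed

lemma chain_step_mono: "\<delta> \<le> \<epsilon> \<Longrightarrow> chain_step m f \<delta> \<subseteq> chain_step m f \<epsilon>"
  unfolding chain_step_def by (blast intro: less_le_trans)

lemma chain_ge_refl: "chain_ge m f x x"
  by (simp add: chain_ge_def has_chain_iff)

lemma chain_ge_trans: "chain_ge m f x y \<Longrightarrow> chain_ge m f y z \<Longrightarrow> chain_ge m f x z"
  unfolding chain_ge_def has_chain_iff by (meson rtrancl_trans)

lemma chain_ge_image:
  assumes "i \<in> {1..m}"
  shows "chain_ge m f x (f i x)"
proof -
  have "(x, f i x) \<in> chain_step m f \<epsilon>" if "\<epsilon> > 0" for \<epsilon>
    unfolding chain_step_def using assms that by (auto intro!: bexI[of _ i])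
  then show ?thesis
    unfolding chain_ge_def has_chain_iff by blast
qed

lemma chain_ge_word_map: "I \<in> words m \<Longrightarrow> chain_ge m f x (word_map f I x)"
proof (induction I arbitrary: x)
  case Nil
  then show ?case by (simp add: word_map_def chain_ge_refl)
next
  case (Cons i I)
  then have "chain_ge m f x (f i x)" "chain_ge m f (f i x) (word_map f I (f i x))"
    by (auto simp: words_def intro: chain_ge_image)
  then show ?case
    by (auto simp: word_map_def intro: chain_ge_trans)
qed

lemma chain_ge_backward:
  assumes "backward_trajectory m f x b"
  shows "chain_ge m f (b n) x"
proof (induction n)
  case 0
  then show ?case using assms by (simp add: backward_trajectory_def chain_ge_refl)
next
  case (Suc n)
  obtain i where "i \<in> {1..m}" "f i (b (Suc n)) = b n"
    using assms unfolding backward_trajectory_def by blast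
  then show ?case using chain_ge_image[of i m f "b (Suc n)"] Suc chain_ge_trans by metis
qed

section \<open>Stability of chains and closedness of the chain relation\<close>

text \<open>The starting point enters a chain only through the first jump, so moving it costs
  \<open>\<delta>\<close> there and nothing later. A first jump must exist, whence the transitive
  closure.\<close>

lemma chain_step_perturb_left:
  assumes "(x, y) \<in> (chain_step m f \<epsilon>)\<^sup>+" and "0 \<le> \<delta>"
    and "\<And>i. i \<in> {1..m} \<Longrightarrow> dist (f i x') (f i x) < \<delta>"
  shows "(x', y) \<in> (chain_step m f (\<epsilon> + \<delta>))\<^sup>+"
proof -
  obtain z where z: "(x, z) \<in> chain_step m f \<epsilon>" "(z, y) \<in> (chain_step m f \<epsilon>)\<^sup>*"
    using tranclD[OF assms(1)] by blast
  obtain i where i: "i \<in> {1..m}" "dist (f i x) z < \<epsilon>"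
    using z(1) by (auto simp: chain_step_def)
  have "dist (f i x') z < \<epsilon> + \<delta>"
    using dist_triangle[of "f i x'" z "f i x"] assms(3)[OF i(1)] i(2) by linarith
  then have "(x', z) \<in> chain_step m f (\<epsilon> + \<delta>)"
    using i(1) by (auto simp: chain_step_def)
  moreover have "(z, y) \<in> (chain_step m f (\<epsilon> + \<delta>))\<^sup>*"
    using z(2) rtrancl_mono[OF chain_step_mono[of \<epsilon> "\<epsilon> + \<delta>" m f]] assms(2) by auto
  ultimately show ?thesis by (rule rtrancl_into_trancl2)
qed

text \<open>Dually, the endpoint enters only as the target of the last jump.\<close>

lemma chain_step_perturb_right:
  assumes "(x, y) \<in> (chain_step m f \<epsilon>)\<^sup>+" and "dist y y' < \<delta>"
  shows "(x, y') \<in> (chain_step m f (\<epsilon> + \<delta>))\<^sup>+"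
proof -
  obtain z where z: "(x, z) \<in> (chain_step m f \<epsilon>)\<^sup>*" "(z, y) \<in> chain_step m f \<epsilon>"
    using tranclD2[OF assms(1)] by blast
  obtain i where i: "i \<in> {1..m}" "dist (f i z) y < \<epsilon>"
    using z(2) by (auto simp: chain_step_def)
  have "dist (f i z) y' < \<epsilon> + \<delta>"
    using dist_triangle[of "f i z" y' y] assms(2) i(2) by linarith
  then have "(z, y') \<in> chain_step m f (\<epsilon> + \<delta>)"
    using i(1) by (auto simp: chain_step_def)
  moreover have "0 \<le> \<delta>"
    using assms(2) zero_le_dist[of y y'] by linarith
  then have "(x, z) \<in> (chain_step m f (\<epsilon> + \<delta>))\<^sup>*"
    using z(1) rtrancl_mono[OF chain_step_mono[of \<epsilon> "\<epsilon> + \<delta>" m f]] by auto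
  ultimately show ?thesis by (rule rtrancl_into_trancl1[rotated])
qed

text \<open>
  Chains of length \<open>0\<close> cannot be perturbed, so limits on the diagonal are treated separately.
\<close>

lemma closed_chain_ge:
  assumes "ifs m f"
  shows "closed {(x, y). chain_ge m f x y}"
  unfolding closed_sequential_limits
proof safe
  fix s :: "nat \<Rightarrow> 'a \<times> 'a" and x y
  assume s: "\<forall>n. s n \<in> {(x, y). chain_ge m f x y}" and lim: "s \<longlonglongrightarrow> (x, y)"
  define u v where "u n = fst (s n)" and "v n = snd (s n)" for n
  have uv: "chain_ge m f (u n) (v n)" for n
    using s[rule_format, of n] by (auto simp: u_def v_def)
  have u: "u \<longlonglongrightarrow> x" and v: "v \<longlonglongrightarrow> y"
    using tendsto_fst[OF lim] tendsto_snd[OF lim] by (simp_all add: u_def[abs_def] v_def[abs_def])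
  show "chain_ge m f x y"
  proof (cases "x = y")
    case True
    then show ?thesis by (simp add: chain_ge_refl)
  next
    case False
    show ?thesis
      unfolding chain_ge_def
    proof (intro allI impI)
      fix \<epsilon> :: real
      assume "\<epsilon> > 0"
      \<comment> \<open>One third is for the chain from \<open>u n\<close> to \<open>v n\<close>,
        one for moving its start to \<open>x\<close>, one for moving its end to
        \<open>y\<close>.\<close>
      define \<delta> where "\<delta> = \<epsilon> / 3"
      have \<delta>: "\<delta> > 0" "\<delta> + \<delta> + \<delta> = \<epsilon>"
        using \<open>\<epsilon> > 0\<close> by (auto simp: \<delta>_def)
      \<comment> \<open>Off the diagonal the endpoints \<open>u n\<close> and \<open>v n\<close>
        eventually differ, which forces the chains between them to have a step.\<close>
      have "(\<lambda>n. dist (u n) (v n)) \<longlonglongrightarrow> dist x y"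
        by (intro tendsto_dist u v)
      then have 1: "\<forall>\<^sub>F n in sequentially. dist (u n) (v n) > 0"
        using False by (intro order_tendstoD(1)) auto
      have 2: "\<forall>\<^sub>F n in sequentially. \<forall>i\<in>{1..m}. dist (f i (u n)) (f i x) < \<delta>"
      proof (rule eventually_ball_finite, simp, rule ballI)
        fix i assume "i \<in> {1..m}"
        then have "isCont (f i) x"
          using assms by (simp add: ifs_def continuous_on_eq_continuous_at)
        then have "(\<lambda>n. f i (u n)) \<longlonglongrightarrow> f i x"
          using u by (rule isCont_tendsto_compose)
        then show "\<forall>\<^sub>F n in sequentially. dist (f i (u n)) (f i x) < \<delta>"
          using \<delta>(1) by (rule tendstoD)
      qed
      have 3: "\<forall>\<^sub>F n in sequentially. dist (v n) y < \<delta>"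
        using v \<delta>(1) by (rule tendstoD)
      obtain n where n: "dist (u n) (v n) > 0" "\<forall>i\<in>{1..m}. dist (f i (u n)) (f i x) < \<delta>"
        "dist (v n) y < \<delta>"
        using eventually_happens'[OF sequentially_bot
            eventually_conj[OF 1 eventually_conj[OF 2 3]]] by blast
      have "(u n, v n) \<in> (chain_step m f \<delta>)\<^sup>*"
        using uv[of n] \<delta>(1) by (auto simp: chain_ge_def has_chain_iff)
      then have "(u n, v n) \<in> (chain_step m f \<delta>)\<^sup>+"
        using n(1) by (auto simp: rtrancl_eq_or_trancl)
      then have "(x, v n) \<in> (chain_step m f (\<delta> + \<delta>))\<^sup>+"
        by (rule chain_step_perturb_left) (use \<delta>(1) n(2) in \<open>auto simp: dist_commute\<close>)
      then have "(x, y) \<in> (chain_step m f (\<delta> + \<delta> + \<delta>))\<^sup>+"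
        using n(3) by (rule chain_step_perturb_right)
      then show "has_chain m f \<epsilon> x y"
        unfolding has_chain_iff \<delta>(2) by (rule trancl_into_rtrancl)
    qed
  qed
qed

section \<open>Minimal points of closed preorders on compact sets\<close>

lemma closed_section:
  assumes "closed {(x, y). R x y}"
  shows "closed {y. R x y}"
proof -
  have "closed (Pair x -` {(x, y). R x y})"
    using assms by (intro closed_vimage continuous_intros)
  then show ?thesis by (simp add: vimage_def)
qed

text \<open>The sets \<open>D y\<close> of points of \<open>K\<close> below \<open>y\<close> are
  compact and shrink as \<open>y\<close> descends. By compactness a chain of such sets has a common
  point \<open>u\<close>, and \<open>D u\<close> is then a lower bound for it, so Zorn's lemma
  applies.\<close>

lemma compact_closed_preorder_minimal:
  fixes K :: "'a::t2_space set"
  assumes "compact K" and cl: "closed {(x, y). R x y}"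
    and refl: "\<And>x. R x x" and trans: "\<And>x y z. R x y \<Longrightarrow> R y z \<Longrightarrow> R x z"
    and "x \<in> K"
  obtains y where "y \<in> K" "R x y" "\<And>z. z \<in> K \<Longrightarrow> R y z \<Longrightarrow> R z y"
proof -
  define D where "D y = {z \<in> K. R y z}" for y
  define \<A> where "\<A> = D ` D x"
  have D_anti: "D z \<subseteq> D y" if "z \<in> D y" for y z
    using that trans by (auto simp: D_def)
  have compact_D: "compact (D y)" for y
  proof -
    have "D y = K \<inter> {z. R y z}" by (auto simp: D_def)
    then show ?thesis using compact_Int_closed[OF assms(1) closed_section[OF cl]] by simp
  qed
  have in_D: "y \<in> D y" if "y \<in> K" for y
    using that refl by (simp add: D_def)
  have "\<exists>M\<in>\<A>. \<forall>A\<in>\<A>. A \<subseteq> M \<longrightarrow> A = M"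
  proof (rule predicate_Zorn)
    \<comment> \<open>The order is reverse inclusion, so the maximal element supplied by Zorn's
      lemma is minimal for inclusion.\<close>
    show "partial_order_on \<A> (relation_of (\<lambda>M A. A \<subseteq> M) \<A>)"
      by (rule partial_order_on_relation_ofI) auto
  next
    fix \<C> assume "\<C> \<in> Chains (relation_of (\<lambda>M A. A \<subseteq> M) \<A>)"
    then have chain: "\<And>S T. S \<in> \<C> \<and> T \<in> \<C> \<Longrightarrow> S \<subseteq> T \<or> T \<subseteq> S" and sub: "\<C> \<subseteq> \<A>"
      by (auto simp: Chains_def relation_of_def)
    show "\<exists>U\<in>\<A>. \<forall>A\<in>\<C>. U \<subseteq> A"
    proof (cases "\<C> = {}")
      case True
      then show ?thesis using in_D[OF \<open>x \<in> K\<close>] by (auto simp: \<A>_def)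
    next
      case False
      \<comment> \<open>A finite non-empty subchain contains its own intersection, which is some
        \<open>D z\<close> and hence contains \<open>z\<close>.\<close>
      have "K \<inter> \<Inter>\<C> \<noteq> {}"
      proof (rule compact_imp_fip[OF assms(1)])
        show "closed T" if "T \<in> \<C>" for T
          using sub that compact_imp_closed[OF compact_D] by (auto simp: \<A>_def)
        show "K \<inter> \<Inter>\<B> \<noteq> {}" if "finite \<B>" "\<B> \<subseteq> \<C>" for \<B>
        proof (cases "\<B> = {}")
          case True
          then show ?thesis using \<open>x \<in> K\<close> by auto
        next
          case False
          have "subset.chain \<A> \<B>"
            unfolding subset_chain_def using that(2) sub chain by blast
          then have "\<Inter>\<B> \<in> \<A>"
            using Inter_in_chain[OF that(1) False] that(2) sub by blast
          then obtain z where "z \<in> K" "\<Inter>\<B> = D z"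
            by (auto simp: \<A>_def D_def[of x])
          then show ?thesis using in_D by blast
        qed
      qed
      then obtain u where u: "u \<in> A" if "A \<in> \<C>" for A by blast
      have below: "D u \<subseteq> A" if "A \<in> \<C>" for A
        using sub that u[OF that] D_anti by (auto simp: \<A>_def)
      obtain A where A: "A \<in> \<C>" using False by blast
      then have "u \<in> D x"
        using sub u[OF A] D_anti by (auto simp: \<A>_def)
      then show ?thesis using below by (auto simp: \<A>_def)
    qed
  qed
  then obtain y where y: "y \<in> D x" and min: "\<And>z. z \<in> D x \<Longrightarrow> D z \<subseteq> D y \<Longrightarrow> D z = D y"
    by (auto simp: \<A>_def)
  show thesis
  proof (rule that)
    show "y \<in> K" "R x y" using y by (auto simp: D_def)
    fix z assume "z \<in> K" "R y z"
    then have "z \<in> D y" by (simp add: D_def)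
    \<comment> \<open>Going down from \<open>y\<close> to \<open>z\<close> cannot shrink the set, so
      \<open>y\<close> itself lies in \<open>D z\<close>.\<close>
    then have "D z = D y"
      using D_anti y by (intro min) auto
    then show "R z y" using in_D[OF \<open>y \<in> K\<close>] by (auto simp: D_def)
  qed
qed

section \<open>Recurrent points below and above a given point\<close>

lemma H_invariant_word_map:
  assumes "H_invariant m f A" "x \<in> A" "I \<in> words m"
  shows "word_map f I x \<in> A"
  using assms(2,3)
proof (induction I arbitrary: x)
  case Nil
  then show ?case by (simp add: word_map_def)
next
  case (Cons i I)
  then have "f i x \<in> hutchinson m f A"
    by (auto simp: hutchinson_def words_def)
  then have "f i x \<in> A"
    using assms(1) by (simp add: H_invariant_def)
  then show ?case
    using Cons by (simp add: words_def word_map_def)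
qed

text \<open>Take \<open>y\<close> minimal for the chain preorder on \<open>A\<close>. By invariance
  its orbit stays in \<open>A\<close>, and every orbit point lies below \<open>y\<close>, so
  minimality gives a return to \<open>y\<close>.\<close>

lemma ow_chain_recurrent_below:
  assumes "ifs m f" "compact A" "H_invariant m f A" "x \<in> A"
  obtains y where "y \<in> A" "y \<in> ow_chain_recurrent m f" "chain_ge m f x y"
proof -
  obtain y where y: "y \<in> A" "chain_ge m f x y"
    and min: "\<And>z. z \<in> A \<Longrightarrow> chain_ge m f y z \<Longrightarrow> chain_ge m f z y"
    by (rule compact_closed_preorder_minimal[of A "chain_ge m f" x])
      (use assms closed_chain_ge chain_ge_refl chain_ge_trans in \<open>blast+\<close>)
  have "y \<in> ow_chain_recurrent m f"
    using H_invariant_word_map[OF assms(3) y(1)] chain_ge_word_map min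
    by (fastforce simp: ow_chain_recurrent_def orbit_of_def chain_equivalent_def)
  then show thesis using that y by blast
qed

text \<open>The points below \<open>x\<close> form a closed set. Were it disjoint from the compact
  set \<open>G\<close>, it would miss a whole neighbourhood of \<open>G\<close>, but attraction of
  \<open>{x}\<close> puts images of \<open>x\<close> under long words there.\<close>

lemma chain_ge_global_attractor:
  assumes "ifs m f" "is_global_attractor m f G"
  obtains y where "y \<in> G" "chain_ge m f x y"
proof -
  have "G \<inter> {y. chain_ge m f x y} \<noteq> {}"
  proof
    assume "G \<inter> {y. chain_ge m f x y} = {}"
    then have sub: "G \<subseteq> - {y. chain_ge m f x y}" by blast
    have "compact G" using assms(2) by (simp add: is_global_attractor_def)
    then obtain d where d: "d > 0" "nbhd d G \<subseteq> - {y. chain_ge m f x y}"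
      unfolding nbhd_def
      by (rule compact_subset_open_imp_ball_epsilon_subset[OF _ _ sub])
        (use closed_section[OF closed_chain_ge[OF assms(1)]] in \<open>auto simp: open_Compl\<close>)
    have "attracts m f G {x}"
      using assms(2) by (simp add: is_global_attractor_def)
    then obtain \<tau> :: nat where
      \<tau>: "\<And>I. I \<in> words m \<Longrightarrow> length I \<ge> \<tau> \<Longrightarrow> word_map f I ` {x} \<subseteq> nbhd d G"
      using d(1) unfolding attracts_def by metis
    \<comment> \<open>Any word of length \<open>\<tau>\<close> would do; the letter 1 is available
      because \<open>1 \<le> m\<close>.\<close>
    define I where "I = replicate \<tau> (1::nat)"
    have I: "I \<in> words m" "length I \<ge> \<tau>"
      using assms(1) by (auto simp: I_def words_def ifs_def)
    then show False
      using \<tau>[OF I] d(2) chain_ge_word_map[OF I(1), of f x] by auto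
  qed
  then show thesis using that by blast
qed

text \<open>All points of a backward trajectory of \<open>x\<close> lie above \<open>x\<close>, and
  closedness of the chain relation passes this on to its limit points.\<close>

lemma ow_chain_recurrent_above:
  assumes "ifs m f" "backward_recurrent_access m f" "closed (global_attractor m f)"
    and "x \<in> global_attractor m f"
  obtains r where "r \<in> global_attractor m f" "r \<in> ow_chain_recurrent m f" "chain_ge m f r x"
proof -
  obtain b r where b: "backward_trajectory m f x b" "range b \<subseteq> global_attractor m f"
    and r: "r \<in> alpha_limit b" "r \<in> ow_chain_recurrent m f"
    using assms(2,4) unfolding backward_recurrent_access_def by blast
  obtain k :: "nat \<Rightarrow> nat" where k: "(b \<circ> k) \<longlonglongrightarrow> r"
    using r(1) unfolding alpha_limit_def by blast
  have "r \<in> global_attractor m f"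
    using closed_sequentially[OF assms(3) _ k] b(2) by auto
  moreover have "(\<lambda>n. ((b \<circ> k) n, x)) \<longlonglongrightarrow> (r, x)"
    by (intro tendsto_Pair k tendsto_const)
  then have "(r, x) \<in> {(x, y). chain_ge m f x y}"
    by (rule closed_sequentially[OF closed_chain_ge[OF assms(1)], rotated])
      (simp add: chain_ge_backward[OF b(1)])
  ultimately show thesis using that r(2) by blast
qed

section \<open>Nodes and connectedness of the graph\<close>

lemma Union_ow_chain_nodes: "\<Union>(ow_chain_nodes m f) = ow_chain_recurrent m f"
  unfolding ow_chain_nodes_def quotient_def chain_equivalent_def using chain_ge_refl by fastforce

text \<open>Ensures that a non-empty collection of nodes has a non-empty union.\<close>

lemma empty_notin_ow_chain_nodes: "{} \<notin> ow_chain_nodes m f"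
  by (auto simp: ow_chain_nodes_def quotient_def chain_equivalent_def intro: chain_ge_refl)

text \<open>The set is the projection of a compact piece of the relation to the second
  coordinate.\<close>

lemma compact_below:
  assumes "compact K" "closed U" "closed {(x, y). R x y}"
  shows "compact {y \<in> K. \<exists>x\<in>K \<inter> U. R x y}"
proof -
  have "{y \<in> K. \<exists>x\<in>K \<inter> U. R x y} = snd ` (((K \<inter> U) \<times> K) \<inter> {(x, y). R x y})"
    by force
  moreover have "compact \<dots>"
    using assms
    by (intro compact_continuous_image continuous_intros compact_Int_closed compact_Times)
  ultimately show ?thesis by simp
qed

theorem theorem8:
  fixes m :: nat and f :: "nat \<Rightarrow> 'a::metric_space \<Rightarrow> 'a"
  assumes "separable_space (euclidean :: 'a topology)"
    and "locally_compact_space (euclidean :: 'a topology)"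
    and "ifs m f"
    and "compact_dynamics m f"
    and "connected (global_attractor m f)"
    and "backward_recurrent_access m f"
  shows "graph_connected (ow_chain_nodes m f) (ow_chain_edges m f)"
  unfolding graph_connected_def
proof (intro allI impI, rule ccontr)
  fix P Q
  assume part: "nodes_partition (ow_chain_nodes m f) P Q"
    and not_linked:
      "\<not> (\<exists>M\<in>P. \<exists>N\<in>Q. (M, N) \<in> ow_chain_edges m f \<or> (N, M) \<in> ow_chain_edges m f)"
  \<comment> \<open>Points from different halves lie in different nodes, so a chain relation between
    them in either direction would be an edge.\<close>
  have no_edge: "\<not> chain_ge m f p q" "\<not> chain_ge m f q p" if pq: "p \<in> \<Union>P" "q \<in> \<Union>Q" for p q
  proof -
    obtain M N where MN: "M \<in> P" "p \<in> M" "N \<in> Q" "q \<in> N"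
      using pq by blast
    then have "M \<in> ow_chain_nodes m f" "N \<in> ow_chain_nodes m f" "M \<noteq> N"
      using part unfolding nodes_partition_def by auto
    moreover have "(M, N) \<notin> ow_chain_edges m f" "(N, M) \<notin> ow_chain_edges m f"
      using not_linked MN by auto
    ultimately show "\<not> chain_ge m f p q" "\<not> chain_ge m f q p"
      using MN by (auto simp: ow_chain_edges_def)
  qed
  obtain G where G: "is_global_attractor m f G" "global_attractor m f = G"
    using assms(4) global_attractor_eqI unfolding compact_dynamics_def by blast
  have compact: "compact G" and inv: "H_invariant m f G"
    using G(1) by (auto simp: is_global_attractor_def)
  define U V where "U = \<Union>P" and "V = \<Union>Q"
  note no_edge = no_edge[folded U_def V_def]
  have closed: "closed U" "closed V"
    using part by (auto simp: nodes_partition_def U_def V_def)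
  have "P \<noteq> {}" "Q \<noteq> {}" "{} \<notin> P" "{} \<notin> Q"
    using part empty_notin_ow_chain_nodes[of m f] unfolding nodes_partition_def by auto
  then have nonempty: "U \<noteq> {}" "V \<noteq> {}"
    unfolding U_def V_def by (metis Sup_bot_conv(1) ex_in_conv)+
  have recurrent: "ow_chain_recurrent m f = U \<union> V"
    using part
    by (simp add: nodes_partition_def U_def V_def flip: Union_ow_chain_nodes Union_Un_distrib)
  have below: "\<exists>y\<in>G. y \<in> U \<union> V \<and> chain_ge m f x y" for x
  proof -
    obtain w where w: "w \<in> G" "chain_ge m f x w"
      by (rule chain_ge_global_attractor[OF assms(3) G(1)])
    obtain y where "y \<in> G" "y \<in> ow_chain_recurrent m f" "chain_ge m f w y"
      by (rule ow_chain_recurrent_below[OF assms(3) compact inv w(1)])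
    then show ?thesis
      using chain_ge_trans[OF w(2)] recurrent by auto
  qed
  have above: "\<exists>r\<in>G. r \<in> U \<union> V \<and> chain_ge m f r x" if "x \<in> G" for x
    using ow_chain_recurrent_above[OF assms(3,6)] that compact_imp_closed[OF compact]
    unfolding G(2) recurrent by metis
  \<comment> \<open>The upper points are taken in \<open>G\<close> as well as in \<open>W\<close>,
    since compactness is what makes the set below them closed.\<close>
  define D where "D W = {y \<in> G. \<exists>x\<in>G \<inter> W. chain_ge m f x y}" for W
  have "closed (D W)" if "closed W" for W
    unfolding D_def by (intro compact_imp_closed compact_below compact that closed_chain_ge assms(3))
  then have "closed (D U)" "closed (D V)"
    using closed by auto
  moreover have "G \<subseteq> D U \<union> D V"
    using above unfolding D_def by blast
  moreover have "D U \<inter> D V \<inter> G = {}"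
  proof (rule equals0I)
    fix x assume "x \<in> D U \<inter> D V \<inter> G"
    then obtain p q where pq: "p \<in> U" "q \<in> V" "chain_ge m f p x" "chain_ge m f q x"
      unfolding D_def by blast
    \<comment> \<open>This recurrent \<open>y\<close> lies below both \<open>p\<close> and
      \<open>q\<close>; whichever half contains it, it is related to a point of the other
      half.\<close>
    obtain y where "y \<in> U \<union> V" "chain_ge m f x y"
      using below by blast
    then show False
      using pq no_edge chain_ge_trans by (metis Un_iff)
  qed
  moreover have "D U \<inter> G \<noteq> {}" "D V \<inter> G \<noteq> {}"
  proof -
    obtain p q where pq: "p \<in> U" "q \<in> V"
      using nonempty by blast
    \<comment> \<open>The points \<open>p\<close> and \<open>q\<close> may lie off the attractor.
      Descending from them reaches recurrent points of \<open>G\<close>, which stay in the same half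
      for want of edges and lie in \<open>D U\<close> and \<open>D V\<close> by reflexivity.\<close>
    obtain y z where "y \<in> G" "y \<in> U \<union> V" "chain_ge m f p y"
      and "z \<in> G" "z \<in> U \<union> V" "chain_ge m f q z"
      using below by meson
    then have "y \<in> G \<inter> U" "z \<in> G \<inter> V"
      using pq no_edge by blast+
    then show "D U \<inter> G \<noteq> {}" "D V \<inter> G \<noteq> {}"
      unfolding D_def using chain_ge_refl by blast+
  qed
  ultimately show False
    using assms(5) unfolding G(2) connected_closed by blast
qed

end
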